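(* The following identities hold: $$\sum_{k=1}^{\infty}(4k+1)\frac{(-\frac12)_k(\frac12)_k^3}{(k+1)!\,k!^3}\sum_{i=1}^{2k}\frac{(-1)^{i-1}}{i^2}=\frac23-\frac{8}{\pi^2},$$ $$\sum_{k=1}^{\infty}(4k+3)\frac{(-\frac12)_k(\frac12)_k^2(\frac32)_k}{k!\,(k+1)!^2\,(k+2)!}\sum_{i=1}^{k}\left(\frac{1}{(2i-1)^2}-\frac{1}{4(i+1)^2}\right)=\frac{32}{27}-\frac{992}{81\pi^2},$$ $$\sum_{k=1}^{\infty}(4k+3)\frac{(\frac32)_k(\frac12)_k^3}{k!\,(k+1)!^3}\sum_{i=1}^{k}\left(\frac{1}{(2i-1)^2}-\frac{1}{4(i+1)^2}\right)=\frac{8}{3}-\frac{24}{\pi^2},$$ $$\sum_{k=1}^{\infty}(-1)^k(4k+3)\frac{(\frac32)_k(\frac12)_k^2}{k!\,(k+1)!^2}\sum_{i=1}^{k}\left(\frac{1}{(1+i)^2}-\frac{4}{(2i-1)^2}\right)=\frac{4\pi}{3}-\frac{8}{\pi}.$$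
   Context: For a complex number $x$, the shifted factorial (Pochhammer symbol) is $(x)_0=1$ and $(x)_n=x(x+1)\cdots(x+n-1)$ for positive integers $n$. *)

theory Defs
  imports "HOL-Analysis.Analysis"
begin

end

theory Submission
  imports Defs "HOL-Real_Asymp.Real_Asymp"
begin

text \<open>
  The four series are second-order coefficients. In Dougall's well-poised summation
  \<open>\<Sum>\<^sub>k (a + 2k)/a (a)\<^sub>k (b)\<^sub>k (c)\<^sub>k (d)\<^sub>k / (k! (1+a-b)\<^sub>k (1+a-c)\<^sub>k (1+a-d)\<^sub>k)\<close>, and in its limit
  \<open>d \<rightarrow> -\<infinity>\<close>, put \<open>c, d = 1/2 \<plusminus> x\<close> (respectively \<open>b, c = 1/2 \<plusminus> x\<close>). The summand is even in \<open>x\<close>, and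
  its \<open>x\<^sup>2\<close>-coefficient is the summand at \<open>x = 0\<close> times the harmonic-type sum; the closed form becomes
  elementary by the reflection formula. The parameters are \<open>(a, b) = (1/2, -1/2)\<close>,
  \<open>(3/2, -1/2)\<close>, \<open>(3/2, 1/2)\<close>, and \<open>a = 3/2\<close> for the alternating series. Tannery's theorem
  justifies taking the coefficient termwise.

  The summations themselves follow from a WZ certificate for the shift \<open>a \<mapsto> a + 1\<close>, since the sum
  tends to its first term 1 as \<open>a \<rightarrow> \<infinity>\<close>.
\<close>

section \<open>Pochhammer symbols and telescoping series\<close>

text \<open>Gauss's limit for the reciprocal Gamma function has one more factor \<open>z + n\<close>
  in its approximants; since \<open>n / (z + n)\<close> tends to 1, dropping that factor lowers the
  exponent to \<open>z - 1\<close>. With \<open>rGamma\<close> the nonpositive integers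
  \<open>z\<close> are covered as well.\<close>

lemma pochhammer_asymp:
  fixes z :: real
  shows "(\<lambda>n. pochhammer z n / (fact n * real n powr (z - 1))) \<longlonglongrightarrow> rGamma z"
proof -
  have "(\<lambda>n. real n / (z + real n)) \<longlonglongrightarrow> 1"
    by real_asymp
  from tendsto_mult[OF rGamma_series_LIMSEQ[of z] this]
  have "(\<lambda>n. rGamma_series z n * (real n / (z + real n))) \<longlonglongrightarrow> rGamma z"
    by simp
  moreover have "\<forall>\<^sub>F n in sequentially. rGamma_series z n * (real n / (z + real n))
      = pochhammer z n / (fact n * real n powr (z - 1))"
    using eventually_gt_at_top[of "nat \<lceil>\<bar>z\<bar>\<rceil> + 1"]
  proof eventually_elim
    case (elim n)
    then have n: "real n > 0" "z + real n > 0" by linarith+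
    then have "real n powr z = real n powr (z - 1) * real n"
      by (simp add: powr_diff)
    with n show ?case
      by (simp add: rGamma_series_def pochhammer_Suc powr_def divide_simps)
  qed
  ultimately show ?thesis
    by (rule Lim_transform_eventually)
qed

lemma pochhammer_mono_base:
  fixes x y :: real
  assumes "0 \<le> x" "x \<le> y"
  shows "pochhammer x k \<le> pochhammer y k"
  unfolding pochhammer_prod using assms by (intro prod_mono) auto

lemma abs_pochhammer_le_fact:
  fixes b :: real
  assumes "\<bar>b\<bar> \<le> 1"
  shows "\<bar>pochhammer b k\<bar> \<le> fact k"
proof -
  have "\<bar>pochhammer b k\<bar> \<le> (\<Prod>i<k. real (i + 1))"
    unfolding pochhammer_prod abs_prod atLeast0LessThan using assms by (intro prod_mono) auto
  also have "\<dots> = fact k"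
    by (simp add: fact_prod_Suc atLeast0LessThan)
  finally show ?thesis .
qed

lemma pochhammer_plus1:
  fixes a :: real
  assumes "a \<noteq> 0"
  shows "pochhammer (a + 1) k = pochhammer a k * (a + k) / a"
proof -
  have "a * pochhammer (a + 1) k = pochhammer a k * (a + k)"
    by (metis pochhammer_rec pochhammer_Suc)
  with assms show ?thesis by (simp add: field_simps)
qed

text \<open>Splitting off the first factors, \<open>a\<close> and 4, leaves shifted symbols that
  compare factor by factor, and the gain is \<open>4 / a\<close>. This gain makes every term after
  the first vanish as \<open>a\<close> grows; at \<open>k = 0\<close> both ratios are 1 and there is
  no gain.\<close>

lemma fact_div_pochhammer_le:
  fixes a :: real
  assumes "a \<ge> 4" "k > 0"
  shows "fact k / pochhammer a k \<le> 4 / a * (fact k / pochhammer 4 k)"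
proof -
  obtain m where m: "k = Suc m" using assms(2) gr0_implies_Suc by blast
  have "a * pochhammer 4 k \<le> 4 * pochhammer a k"
    using assms(1) pochhammer_mono_base[of 5 "a + 1" m]
    by (simp add: m pochhammer_rec mult_left_mono)
  moreover have "pochhammer a k > 0" "pochhammer 4 k > (0::real)"
    using assms by (auto intro!: pochhammer_pos)
  ultimately show ?thesis
    using assms by (simp add: field_simps)
qed

lemma pochhammer_4: "pochhammer 4 k = (fact (k + 3) :: real) / 6"
proof (induction k)
  case (Suc k)
  have "fact (Suc k + 3) = (real k + 4) * fact (k + 3)"
    using fact_Suc[where ?'a = real, of "k + 3"] by (simp del: fact_Suc)
  with Suc show ?case
    by (simp add: pochhammer_Suc add.commute mult.commute)
qed (simp add: fact_numeral)

text \<open>The ratio of \<open>fact k\<close> to \<open>pochhammer a k\<close> decays like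
  \<open>k\<close> to the power \<open>1 - a\<close>, so with the linear factor the base must exceed
  3. The base 4 is the first integer that works and gives decay of order
  \<open>1 / k^2\<close>.\<close>

lemma summable_wellpoised_majorant:
  "summable (\<lambda>k. (1 + 2 * real k) * (fact k / pochhammer 4 k))"
proof (rule summable_comparison_test_bigo)
  have "fact (k + 3) = fact k * ((real k + 1) * (real k + 2) * (real k + 3))" for k
    by (simp add: numeral_3_eq_3 algebra_simps)
  then have eq: "(1 + 2 * real k) * (fact k / pochhammer 4 k)
     = 6 * (1 + 2 * real k) / ((real k + 1) * (real k + 2) * (real k + 3))" for k
    by (simp add: pochhammer_4)
  show "(\<lambda>k. (1 + 2 * real k) * (fact k / pochhammer 4 k)) \<in> O(\<lambda>k. real k powr (-2))"
    unfolding eq by real_asymp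
  show "summable (\<lambda>k. norm (real k powr (-2)))"
    by (simp add: summable_real_powr_iff)
qed

section \<open>From telescoping certificates to closed forms\<close>

text \<open>The WZ step: the certificate \<open>G\<close> telescopes, and because it vanishes at 0
  and at infinity the two series are proportional.\<close>

lemma suminf_wz:
  fixes t t' G :: "nat \<Rightarrow> real"
  assumes "summable t" "summable t'"
    and "\<And>k. \<alpha> * t k - \<beta> * t' k = G (Suc k) - G k" "G 0 = 0" "G \<longlonglongrightarrow> 0"
  shows "\<alpha> * suminf t = \<beta> * suminf t'"
proof -
  have "(\<lambda>k. \<alpha> * t k - \<beta> * t' k) sums (0 - G 0)"
    unfolding assms(3) by (rule telescope_sums[OF assms(5)])
  moreover have "(\<lambda>k. \<alpha> * t k - \<beta> * t' k) sums (\<alpha> * suminf t - \<beta> * suminf t')"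
    by (intro sums_diff sums_mult summable_sums assms)
  ultimately show ?thesis
    using assms(4) sums_unique2 by fastforce
qed

text \<open>Iterating the recurrence expresses \<open>f 0\<close> as a partial product times
  \<open>f n\<close>; the normalisation of \<open>f\<close> at infinity leaves only the infinite
  product.\<close>

lemma first_order_recurrence_limit:
  fixes f \<alpha> \<beta> :: "nat \<Rightarrow> real"
  assumes "\<And>n. \<alpha> n \<noteq> 0" "\<And>n. \<alpha> n * f n = \<beta> n * f (Suc n)"
    and "f \<longlonglongrightarrow> 1" "(\<lambda>n. \<Prod>j<n. \<beta> j / \<alpha> j) \<longlonglongrightarrow> L"
  shows "f 0 = L"
proof -
  have "f 0 = (\<Prod>j<n. \<beta> j / \<alpha> j) * f n" for n
  proof (induction n)
    case (Suc n)
    have "f n = \<beta> n / \<alpha> n * f (Suc n)"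
      using assms(1,2)[of n] by (simp add: field_simps)
    with Suc show ?case by (simp add: mult.assoc)
  qed simp
  then have "(\<lambda>n. (\<Prod>j<n. \<beta> j / \<alpha> j) * f n) \<longlonglongrightarrow> f 0"
    by simp
  moreover have "(\<lambda>n. (\<Prod>j<n. \<beta> j / \<alpha> j) * f n) \<longlonglongrightarrow> L * 1"
    by (intro tendsto_mult assms)
  ultimately show ?thesis
    using LIMSEQ_unique by fastforce
qed

text \<open>The head contributes exactly 1, and the tail is at most \<open>e n\<close> times one
  fixed convergent sum.\<close>

lemma suminf_tendsto_1:
  fixes t :: "nat \<Rightarrow> nat \<Rightarrow> real"
  assumes "\<forall>\<^sub>F n in sequentially. t n 0 = 1 \<and> (\<forall>k>0. \<bar>t n k\<bar> \<le> e n * M k)"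
    and "summable M" "e \<longlonglongrightarrow> 0"
  shows "(\<lambda>n. suminf (t n)) \<longlonglongrightarrow> 1"
proof -
  have "\<forall>\<^sub>F n in sequentially. norm (suminf (t n) - 1) \<le> e n * suminf (\<lambda>k. M (Suc k))"
    using assms(1)
  proof eventually_elim
    case (elim n)
    have M: "summable (\<lambda>k. M (Suc k))"
      using assms(2) by (simp add: summable_Suc_iff)
    have eM: "summable (\<lambda>k. e n * M (Suc k))"
      by (intro summable_mult M)
    have ab: "summable (\<lambda>k. \<bar>t n (Suc k)\<bar>)"
      by (rule summable_comparison_test'[OF eM]) (use elim in auto)
    then have "summable (\<lambda>k. t n (Suc k))"
      by (rule summable_rabs_cancel)
    then have "suminf (t n) - 1 = suminf (\<lambda>k. t n (Suc k))"
      using elim by (subst suminf_split_head) (auto simp: summable_Suc_iff)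
    moreover have "\<bar>suminf (\<lambda>k. t n (Suc k))\<bar> \<le> (\<Sum>k. \<bar>t n (Suc k)\<bar>)"
      by (rule summable_rabs[OF ab])
    moreover have "\<dots> \<le> (\<Sum>k. e n * M (Suc k))"
      by (intro suminf_le ab eM) (use elim in auto)
    moreover have "\<dots> = e n * suminf (\<lambda>k. M (Suc k))"
      by (rule suminf_mult[OF M])
    ultimately show ?case by simp
  qed
  moreover have "(\<lambda>n. e n * suminf (\<lambda>k. M (Suc k))) \<longlonglongrightarrow> 0"
    using tendsto_mult_left_zero[OF assms(3)] .
  ultimately have "(\<lambda>n. suminf (t n) - 1) \<longlonglongrightarrow> 0"
    by (rule Lim_null_comparison)
  then show ?thesis by (simp add: LIM_zero_iff)
qed

section \<open>Well-poised summations\<close>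

lemma pochhammer_quotient_asymp:
  fixes u v :: real
  assumes "v > 0"
  shows "(\<lambda>n. pochhammer u n / pochhammer v n * real n powr (v - u)) \<longlonglongrightarrow> rGamma u / rGamma v"
proof (rule Lim_transform_eventually)
  show "(\<lambda>n. (pochhammer u n / (fact n * real n powr (u - 1))) / (pochhammer v n / (fact n * real n powr (v - 1))))
      \<longlonglongrightarrow> rGamma u / rGamma v"
    using assms by (intro tendsto_divide pochhammer_asymp) (auto simp: rGamma_eq_zero_iff)
  show "\<forall>\<^sub>F n in sequentially.
      (pochhammer u n / (fact n * real n powr (u - 1))) / (pochhammer v n / (fact n * real n powr (v - 1)))
      = pochhammer u n / pochhammer v n * real n powr (v - u)"
    using eventually_gt_at_top[of 0] by eventually_elim (simp add: powr_diff)
qed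

text \<open>The very-well-poised factor \<open>(a + 2 * k) / a\<close>, which is the quotient of the
  shifted factorials of \<open>1 + a/2\<close> and \<open>a/2\<close>, is kept outside. Together
  with it this is the summand of Dougall's 5F4 at argument 1.\<close>

definition wp5_weight :: "real \<Rightarrow> real \<Rightarrow> real \<Rightarrow> real \<Rightarrow> nat \<Rightarrow> real" where
  "wp5_weight a b c d k = pochhammer a k * pochhammer b k * pochhammer c k * pochhammer d k
     / (fact k * pochhammer (1 + a - b) k * pochhammer (1 + a - c) k * pochhammer (1 + a - d) k)"

text \<open>The limit of \<^const>\<open>wp5_weight\<close> as \<open>d \<rightarrow> -\<infinity>\<close>.\<close>

definition wp4_weight :: "real \<Rightarrow> real \<Rightarrow> real \<Rightarrow> nat \<Rightarrow> real" where
  "wp4_weight a b c k = (-1) ^ k * pochhammer a k * pochhammer b k * pochhammer c k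
     / (fact k * pochhammer (1 + a - b) k * pochhammer (1 + a - c) k)"

text \<open>Each numerator symbol is paired with its well-poised partner, and \<open>a\<close> with
  1 because \<open>fact k\<close> is the symbol of 1. The four exponents from
  \<open>pochhammer_quotient_asymp\<close> then add up.\<close>

lemma wp5_weight_bigo:
  assumes "1 + a - b > 0" "1 + a - c > 0" "1 + a - d > 0"
  shows "wp5_weight a b c d \<in> O(\<lambda>k. real k powr (2 * (b + c + d) - 2 * a - 4))"
proof (rule bigoI_tendsto)
  let ?q = "\<lambda>u v n. pochhammer u n / pochhammer v n * real n powr (v - u)"
  have "(\<lambda>n. ?q a 1 n * ?q b (1 + a - b) n * (?q c (1 + a - c) n * ?q d (1 + a - d) n))
     \<longlonglongrightarrow> rGamma a / rGamma 1 * (rGamma b / rGamma (1 + a - b))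
      * (rGamma c / rGamma (1 + a - c) * (rGamma d / rGamma (1 + a - d)))"
    using assms by (intro tendsto_mult pochhammer_quotient_asymp) auto
  moreover have "\<forall>\<^sub>F n in sequentially. ?q a 1 n * ?q b (1 + a - b) n * (?q c (1 + a - c) n * ?q d (1 + a - d) n)
     = wp5_weight a b c d n / real n powr (2 * (b + c + d) - 2 * a - 4)"
    using eventually_gt_at_top[of 0]
  proof eventually_elim
    case (elim n)
    have "real n powr (1 - a) * real n powr (1 + a - b - b) * (real n powr (1 + a - c - c) * real n powr (1 + a - d - d))
       = real n powr - (2 * (b + c + d) - 2 * a - 4)"
      unfolding powr_add[symmetric] by (simp add: algebra_simps)
    then have "real n powr (1 - a) * real n powr (1 + a - b - b) * (real n powr (1 + a - c - c) * real n powr (1 + a - d - d))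
       = 1 / real n powr (2 * (b + c + d) - 2 * a - 4)"
      by (simp only: powr_minus_divide)
    moreover have "?q a 1 n * ?q b (1 + a - b) n * (?q c (1 + a - c) n * ?q d (1 + a - d) n)
       = wp5_weight a b c d n * (real n powr (1 - a) * real n powr (1 + a - b - b)
         * (real n powr (1 + a - c - c) * real n powr (1 + a - d - d)))"
      by (simp add: wp5_weight_def pochhammer_fact[symmetric] mult_ac)
    ultimately show ?case by simp
  qed
  ultimately show "(\<lambda>n. wp5_weight a b c d n / real n powr (2 * (b + c + d) - 2 * a - 4))
     \<longlonglongrightarrow> rGamma a / rGamma 1 * (rGamma b / rGamma (1 + a - b))
      * (rGamma c / rGamma (1 + a - c) * (rGamma d / rGamma (1 + a - d)))"
    by (rule Lim_transform_eventually)
  show "\<forall>\<^sub>F n in sequentially. real n powr (2 * (b + c + d) - 2 * a - 4) \<noteq> 0"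
    using eventually_gt_at_top[of 0] by eventually_elim simp
qed

lemma wp4_weight_bigo:
  assumes "1 + a - b > 0" "1 + a - c > 0"
  shows "wp4_weight a b c \<in> O(\<lambda>k. real k powr (2 * (b + c) - a - 3))"
proof -
  have "(\<lambda>n. (-1) ^ n * wp4_weight a b c n) \<in> O(\<lambda>k. real k powr (2 * (b + c) - a - 3))"
  proof (rule bigoI_tendsto)
    let ?q = "\<lambda>u v n. pochhammer u n / pochhammer v n * real n powr (v - u)"
    have "(\<lambda>n. ?q a 1 n * ?q b (1 + a - b) n * ?q c (1 + a - c) n)
       \<longlonglongrightarrow> rGamma a / rGamma 1 * (rGamma b / rGamma (1 + a - b)) * (rGamma c / rGamma (1 + a - c))"
      using assms by (intro tendsto_mult pochhammer_quotient_asymp) auto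
    moreover have "\<forall>\<^sub>F n in sequentially. ?q a 1 n * ?q b (1 + a - b) n * ?q c (1 + a - c) n
       = (-1) ^ n * wp4_weight a b c n / real n powr (2 * (b + c) - a - 3)"
      using eventually_gt_at_top[of 0]
    proof eventually_elim
      case (elim n)
      have "real n powr (1 - a) * real n powr (1 + a - b - b) * real n powr (1 + a - c - c)
         = real n powr - (2 * (b + c) - a - 3)"
        unfolding powr_add[symmetric] by (simp add: algebra_simps)
      then have "real n powr (1 - a) * real n powr (1 + a - b - b) * real n powr (1 + a - c - c)
         = 1 / real n powr (2 * (b + c) - a - 3)"
        by (simp only: powr_minus_divide)
      moreover have "?q a 1 n * ?q b (1 + a - b) n * ?q c (1 + a - c) n
         = (-1) ^ n * wp4_weight a b c n * (real n powr (1 - a) * real n powr (1 + a - b - b)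
           * real n powr (1 + a - c - c))"
        by (simp add: wp4_weight_def pochhammer_fact[symmetric] power_mult_distrib[symmetric] mult_ac)
      ultimately show ?case by simp
    qed
    ultimately show "(\<lambda>n. (-1) ^ n * wp4_weight a b c n / real n powr (2 * (b + c) - a - 3))
       \<longlonglongrightarrow> rGamma a / rGamma 1 * (rGamma b / rGamma (1 + a - b)) * (rGamma c / rGamma (1 + a - c))"
      by (rule Lim_transform_eventually)
    show "\<forall>\<^sub>F n in sequentially. real n powr (2 * (b + c) - a - 3) \<noteq> 0"
      using eventually_gt_at_top[of 0] by eventually_elim simp
  qed
  \<comment> \<open>The factor \<open>(-1) ^ n\<close> was inserted to cancel the alternation so
    that the quotient has a limit; taking absolute values removes it again.\<close>
  then have "(\<lambda>n. \<bar>(-1) ^ n * wp4_weight a b c n\<bar>) \<in> O(\<lambda>k. real k powr (2 * (b + c) - a - 3))"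
    by (simp only: landau_o.big.abs_in_iff)
  then show ?thesis
    by (simp add: abs_mult power_abs del: landau_o.big.abs_in_iff) (simp only: landau_o.big.abs_in_iff)
qed

lemma summable_linear_mult_bigo:
  fixes w :: "nat \<Rightarrow> real"
  assumes "w \<in> O(\<lambda>k. real k powr e)" "e < - 2"
  shows "summable (\<lambda>k. \<bar>(p + q * real k) * w k\<bar>)"
proof (rule summable_comparison_test_bigo)
  have "(\<lambda>k. p + q * real k) \<in> O(\<lambda>k. real k powr 1)"
    by real_asymp
  from landau_o.big.mult[OF this assms(1)]
  show "(\<lambda>k. \<bar>(p + q * real k) * w k\<bar>) \<in> O(\<lambda>k. real k powr (1 + e))"
    by (simp only: landau_o.big.abs_in_iff powr_add)
  show "summable (\<lambda>k. norm (real k powr (1 + e)))"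
    using assms(2) by (simp add: summable_real_powr_iff)
qed

text \<open>This disposes of the boundary terms of the certificates, which are polynomials of degree
  at most 2 times the weight.\<close>

lemma quadratic_mult_bigo_tendsto_0:
  fixes w :: "nat \<Rightarrow> real"
  assumes "w \<in> O(\<lambda>k. real k powr e)" "e < - 2"
  shows "(\<lambda>k. (p + q * real k + r * real k ^ 2) * w k) \<longlonglongrightarrow> 0"
proof -
  have "(\<lambda>k. p + q * real k + r * real k ^ 2) \<in> O(\<lambda>k. real k powr 2)"
    by real_asymp
  from landau_o.big.mult[OF this assms(1)]
  have "(\<lambda>k. (p + q * real k + r * real k ^ 2) * w k) \<in> O(\<lambda>k. real k powr (2 + e))"
    by (simp only: powr_add)
  also have "(\<lambda>k. real k powr (2 + e)) \<in> o(\<lambda>_. 1)"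
    using assms(2) by real_asymp
  finally show ?thesis
    by (auto dest: smalloD_tendsto)
qed

section \<open>WZ certificates for the shift of \<open>a\<close>\<close>

lemma wp5_weight_Suc:
  "wp5_weight a b c d (Suc k) = wp5_weight a b c d k * ((a + k) * (b + k) * (c + k) * (d + k))
     / ((1 + k) * (1 + a - b + k) * (1 + a - c + k) * (1 + a - d + k))"
  by (simp add: wp5_weight_def pochhammer_Suc mult_ac)

lemma wp5_weight_shift:
  assumes "a > 0" "1 + a - b > 0" "1 + a - c > 0" "1 + a - d > 0"
  shows "wp5_weight (a + 1) b c d k = wp5_weight a b c d k
     * ((a + k) * (1 + a - b) * (1 + a - c) * (1 + a - d))
     / (a * (1 + a - b + k) * (1 + a - c + k) * (1 + a - d + k))"
proof -
  have "pochhammer (1 + (a + 1) - x) k = pochhammer (1 + a - x) k * (1 + a - x + k) / (1 + a - x)"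
    if "1 + a - x > 0" for x
    using pochhammer_plus1[of "1 + a - x" k] that by (simp add: algebra_simps)
  with assms show ?thesis
    by (simp add: wp5_weight_def pochhammer_plus1 mult_ac)
qed

lemma wp4_weight_Suc:
  "wp4_weight a b c (Suc k) = - wp4_weight a b c k * ((a + k) * (b + k) * (c + k))
     / ((1 + k) * (1 + a - b + k) * (1 + a - c + k))"
  by (simp add: wp4_weight_def pochhammer_Suc mult_ac)

lemma wp4_weight_shift:
  assumes "a > 0" "1 + a - b > 0" "1 + a - c > 0"
  shows "wp4_weight (a + 1) b c k = wp4_weight a b c k
     * ((a + k) * (1 + a - b) * (1 + a - c)) / (a * (1 + a - b + k) * (1 + a - c + k))"
proof -
  have "pochhammer (1 + (a + 1) - x) k = pochhammer (1 + a - x) k * (1 + a - x + k) / (1 + a - x)"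
    if "1 + a - x > 0" for x
    using pochhammer_plus1[of "1 + a - x" k] that by (simp add: algebra_simps)
  with assms show ?thesis
    by (simp add: wp4_weight_def pochhammer_plus1 mult_ac)
qed

text \<open>The certificate is the weight times \<open>k * (k + 1 + 2 * a - b - c - d)\<close>, up
  to a constant. Shifting \<open>k\<close> or \<open>a\<close> multiplies the weight by a rational
  function, so after division by the common factors only the polynomial identity \<open>poly\<close>
  remains.\<close>

lemma wp5_wz:
  assumes "a > 0" "1 + a - b > 0" "1 + a - c > 0" "1 + a - d > 0"
  shows "(1 + a - b - c - d) * ((1 + a - b) * (1 + a - c) * (1 + a - d)) * ((a + 2 * real k) / a * wp5_weight a b c d k)
    - (1 + a) * ((1 + a - b - c) * (1 + a - b - d) * (1 + a - c - d))
      * ((a + 1 + 2 * real k) / (a + 1) * wp5_weight (a + 1) b c d k)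
    = - (1 + a - b) * (1 + a - c) * (1 + a - d) / a
        * (real (Suc k) * (real (Suc k) + 1 + 2 * a - b - c - d) * wp5_weight a b c d (Suc k)
           - real k * (real k + 1 + 2 * a - b - c - d) * wp5_weight a b c d k)"
proof -
  define w x y z s where "w = wp5_weight a b c d k"
    and "x = 1 + a - b + k" and "y = 1 + a - c + k" and "z = 1 + a - d + k" and "s = real k"
  define B C D where "B = 1 + a - b" and "C = 1 + a - c" and "D = 1 + a - d"
  have nz: "a \<noteq> 0" "1 + a \<noteq> 0" "x \<noteq> 0" "y \<noteq> 0" "z \<noteq> 0" "1 + s \<noteq> 0"
    using assms by (auto simp: x_def y_def z_def s_def)
  have poly: "(1 + a - b - c - d) * (a + 2 * s) * (x * y * z)
      - ((1 + a - b - c) * (1 + a - b - d) * (1 + a - c - d)) * (a + 1 + 2 * s) * (a + s)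
    = - ((1 + s + 1 + 2 * a - b - c - d) * ((a + s) * (b + s) * (c + s) * (d + s))
         - s * (s + 1 + 2 * a - b - c - d) * (x * y * z))"
    unfolding x_def y_def z_def s_def by algebra
  \<comment> \<open>The polynomial coefficients are abstracted to \<open>e\<close>,
    \<open>E\<close>, \<open>p\<close>, \<open>p'\<close>, \<open>n\<close>, so that denominators
    are cleared without expanding them; \<open>u\<close> below absorbs the common
    denominator.\<close>
  have "e * (B * C * D) * ((a + 2 * s) / a * w)
    - (1 + a) * E * ((a + 1 + 2 * s) / (a + 1) * (w * ((a + s) * B * C * D) / (a * x * y * z)))
    = - B * C * D / a * ((1 + s) * p' * (w * n / ((1 + s) * x * y * z)) - s * p * w)"
    if "e * (a + 2 * s) * (x * y * z) - E * (a + 1 + 2 * s) * (a + s) = - (p' * n - s * p * (x * y * z))"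
    for e E p p' n
  proof -
    define u where "u = w / (a * x * y * z)"
    have w: "w = u * (a * x * y * z)"
      using nz by (simp add: u_def)
    have "e * (B * C * D) * ((a + 2 * s) / a * w) = B * C * D * u * (e * (a + 2 * s) * (x * y * z))"
      using nz by (simp add: w)
    moreover have "(1 + a) * E * ((a + 1 + 2 * s) / (a + 1) * (w * ((a + s) * B * C * D) / (a * x * y * z)))
        = B * C * D * u * (E * (a + 1 + 2 * s) * (a + s))"
      using nz by (simp add: w add.commute[of a 1])
    moreover have "- B * C * D / a * ((1 + s) * p' * (w * n / ((1 + s) * x * y * z)) - s * p * w)
        = - (B * C * D * u * (p' * n - s * p * (x * y * z)))"
    proof -
      have eqs: "(1 + s) * p' * (w * n / ((1 + s) * x * y * z)) = a * (u * (p' * n))"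
        "s * p * w = a * (u * (s * p * (x * y * z)))"
        using nz by (simp_all add: w)
      show ?thesis
        unfolding eqs right_diff_distrib[symmetric] using nz(1) by (simp add: mult.assoc)
    qed
    ultimately show ?thesis
      by (simp only: right_diff_distrib[symmetric] that mult_minus_right)
  qed
  from this[OF poly] show ?thesis
    unfolding wp5_weight_Suc wp5_weight_shift[OF assms]
      w_def x_def y_def z_def s_def B_def C_def D_def
    by (simp only: of_nat_Suc)
qed

text \<open>This is the leading coefficient in \<open>d\<close> of \<open>wp5_wz\<close>: both sides
  grow like \<open>d^2\<close>, and the quadratic factor of the certificate degenerates to
  \<open>k\<close>.\<close>

lemma wp4_wz:
  assumes "a > 0" "1 + a - b > 0" "1 + a - c > 0"
  shows "(1 + a - b) * (1 + a - c) * ((a + 2 * real k) / a * wp4_weight a b c k)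
    - (1 + a) * (1 + a - b - c) * ((a + 1 + 2 * real k) / (a + 1) * wp4_weight (a + 1) b c k)
    = - (1 + a - b) * (1 + a - c) / a * (real (Suc k) * wp4_weight a b c (Suc k) - real k * wp4_weight a b c k)"
proof -
  define w x y s where "w = wp4_weight a b c k"
    and "x = 1 + a - b + k" and "y = 1 + a - c + k" and "s = real k"
  define B C where "B = 1 + a - b" and "C = 1 + a - c"
  have nz: "a \<noteq> 0" "1 + a \<noteq> 0" "x \<noteq> 0" "y \<noteq> 0" "1 + s \<noteq> 0"
    using assms by (auto simp: x_def y_def s_def)
  have poly: "(a + 2 * s) * (x * y) - (1 + a - b - c) * (a + 1 + 2 * s) * (a + s)
    = (a + s) * (b + s) * (c + s) + s * (x * y)"
    unfolding x_def y_def s_def by algebra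
  have "B * C * ((a + 2 * s) / a * w)
    - (1 + a) * (1 + a - b - c) * ((a + 1 + 2 * s) / (a + 1) * (w * ((a + s) * B * C) / (a * x * y)))
    = B * C * w / (a * x * y) * ((a + 2 * s) * (x * y) - (1 + a - b - c) * (a + 1 + 2 * s) * (a + s))"
    using nz by (simp add: divide_simps) algebra
  also have "\<dots> = - B * C / a
        * ((1 + s) * (- w * ((a + s) * (b + s) * (c + s)) / ((1 + s) * x * y)) - s * w)"
    unfolding poly using nz by (simp add: divide_simps) algebra
  finally show ?thesis
    unfolding wp4_weight_Suc wp4_weight_shift[OF assms]
      w_def x_def y_def s_def B_def C_def
    by (simp only: of_nat_Suc)
qed

section \<open>Bounds uniform in \<open>a\<close> and absolute convergence\<close>

text \<open>For parameters in \<open>[-1, 1]\<close> the partner \<open>1 + a - c\<close> is at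
  least \<open>a\<close>, so denominators dominate. The third bound retains a ratio that decays as
  \<open>a\<close> grows.\<close>

lemma wp_factor_bounds:
  fixes a b c :: real
  assumes "a \<ge> 1" "\<bar>b\<bar> \<le> 1" "\<bar>c\<bar> \<le> 1"
  shows "\<bar>pochhammer a k / pochhammer (1 + a - c) k\<bar> \<le> 1"
    and "\<bar>pochhammer b k / fact k\<bar> \<le> 1"
    and "\<bar>pochhammer b k / pochhammer (1 + a - c) k\<bar> \<le> fact k / pochhammer a k"
    and "fact k / pochhammer a k \<le> 1"
proof -
  have pos: "pochhammer a k > 0"
    using assms by (intro pochhammer_pos) auto
  have le: "pochhammer a k \<le> pochhammer (1 + a - c) k"
    using assms by (intro pochhammer_mono_base) auto
  with pos show "\<bar>pochhammer a k / pochhammer (1 + a - c) k\<bar> \<le> 1"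
    by simp
  show "\<bar>pochhammer b k / fact k\<bar> \<le> 1"
    using abs_pochhammer_le_fact[OF assms(2)] by simp
  show "\<bar>pochhammer b k / pochhammer (1 + a - c) k\<bar> \<le> fact k / pochhammer a k"
    using frac_le[OF _ abs_pochhammer_le_fact[OF assms(2)] pos le] pos le by simp
  show "fact k / pochhammer a k \<le> 1"
    using pochhammer_mono_base[of 1 a k] assms pos by (simp add: pochhammer_fact)
qed

lemma abs_mult_mono:
  fixes x y u v :: real
  assumes "\<bar>x\<bar> \<le> u" "\<bar>y\<bar> \<le> v"
  shows "\<bar>x * y\<bar> \<le> u * v"
  unfolding abs_mult by (rule mult_mono[OF assms order_trans[OF abs_ge_zero assms(1)] abs_ge_zero])

lemma wp5_term_bound:
  assumes "a \<ge> 4" "\<bar>b\<bar> \<le> 1" "\<bar>c\<bar> \<le> 1" "\<bar>d\<bar> \<le> 1" "k > 0"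
  shows "\<bar>(a + 2 * real k) / a * wp5_weight a b c d k\<bar> \<le> 4 / a * ((1 + 2 * real k) * (fact k / pochhammer 4 k))"
proof -
  let ?r = "fact k / pochhammer a k"
  have a1: "a \<ge> 1" using assms by simp
  note B = wp_factor_bounds[OF a1]
  have lin: "\<bar>(a + 2 * real k) / a\<bar> \<le> 1 + 2 * real k"
    using assms by (simp add: field_simps add_mono mult_left_mono)
  \<comment> \<open>In this grouping three of the quotients are bounded by 1, and the third one
    supplies the decaying ratio \<open>?r\<close>.\<close>
  have "wp5_weight a b c d k = (pochhammer a k / pochhammer (1 + a - b) k * (pochhammer b k / fact k))
      * ((pochhammer c k / pochhammer (1 + a - c) k) * (pochhammer d k / pochhammer (1 + a - d) k))"
    by (simp add: wp5_weight_def mult_ac)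
  also have "\<bar>\<dots>\<bar> \<le> (1 * 1) * (?r * 1)"
    by (rule abs_mult_mono[OF abs_mult_mono[OF B(1) B(2)] abs_mult_mono[OF B(3) order_trans[OF B(3) B(4)]]])
      (use assms in auto)
  finally have w: "\<bar>wp5_weight a b c d k\<bar> \<le> ?r" by simp
  have "\<bar>(a + 2 * real k) / a * wp5_weight a b c d k\<bar> \<le> (1 + 2 * real k) * ?r"
    by (rule abs_mult_mono[OF lin w])
  also have "\<dots> \<le> (1 + 2 * real k) * (4 / a * (fact k / pochhammer 4 k))"
    using assms by (intro mult_left_mono fact_div_pochhammer_le) auto
  finally show ?thesis by (simp add: mult_ac)
qed

lemma wp4_term_bound:
  assumes "a \<ge> 4" "\<bar>b\<bar> \<le> 1" "\<bar>c\<bar> \<le> 1" "k > 0"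
  shows "\<bar>(a + 2 * real k) / a * wp4_weight a b c k\<bar> \<le> 4 / a * ((1 + 2 * real k) * (fact k / pochhammer 4 k))"
proof -
  let ?r = "fact k / pochhammer a k"
  have a1: "a \<ge> 1" using assms by simp
  note B = wp_factor_bounds[OF a1]
  have lin: "\<bar>(a + 2 * real k) / a\<bar> \<le> 1 + 2 * real k"
    using assms by (simp add: field_simps add_mono mult_left_mono)
  have "\<bar>wp4_weight a b c k\<bar> = \<bar>(pochhammer a k / pochhammer (1 + a - b) k * (pochhammer b k / fact k))
      * (pochhammer c k / pochhammer (1 + a - c) k)\<bar>"
    by (simp add: wp4_weight_def abs_mult power_abs)
  also have "\<dots> \<le> (1 * 1) * ?r"
    by (rule abs_mult_mono[OF abs_mult_mono[OF B(1) B(2)] B(3)]) (use assms in auto)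
  finally have w: "\<bar>wp4_weight a b c k\<bar> \<le> ?r" by simp
  have "\<bar>(a + 2 * real k) / a * wp4_weight a b c k\<bar> \<le> (1 + 2 * real k) * ?r"
    by (rule abs_mult_mono[OF lin w])
  also have "\<dots> \<le> (1 + 2 * real k) * (4 / a * (fact k / pochhammer 4 k))"
    using assms by (intro mult_left_mono fact_div_pochhammer_le) auto
  finally show ?thesis by (simp add: mult_ac)
qed

lemma summable_wp5:
  assumes "1 + a - b > 0" "1 + a - c > 0" "1 + a - d > 0" "b + c + d < 1 + a"
  shows "summable (\<lambda>k. \<bar>(a + 2 * real k) / a * wp5_weight a b c d k\<bar>)"
  using summable_linear_mult_bigo[OF wp5_weight_bigo[OF assms(1-3)], of 1 "2 / a"]
    summable_linear_mult_bigo[OF wp5_weight_bigo[OF assms(1-3)], of 0 0] assms(4)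
  by (cases "a = 0") (auto simp: add_divide_distrib)

lemma summable_wp4:
  assumes "1 + a - b > 0" "1 + a - c > 0" "2 * (b + c) < 1 + a"
  shows "summable (\<lambda>k. \<bar>(a + 2 * real k) / a * wp4_weight a b c k\<bar>)"
  using summable_linear_mult_bigo[OF wp4_weight_bigo[OF assms(1-2)], of 1 "2 / a"]
    summable_linear_mult_bigo[OF wp4_weight_bigo[OF assms(1-2)], of 0 0] assms(3)
  by (cases "a = 0") (auto simp: add_divide_distrib)

section \<open>The two summation theorems\<close>

text \<open>Dougall's 5F4 sum. Factors such as \<open>1 + a - b - c\<close> may be nonpositive under
  these hypotheses; writing them with \<open>rGamma\<close> makes the value vanish correctly at the
  poles of Gamma.\<close>

theorem well_poised_5F4_sums:
  assumes "a > 0" "\<bar>b\<bar> \<le> 1" "\<bar>c\<bar> \<le> 1" "\<bar>d\<bar> \<le> 1" "b + c + d < 1 + a"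
  shows "(\<lambda>k. (a + 2 * real k) / a * wp5_weight a b c d k) sums
    (rGamma (1 + a) * rGamma (1 + a - b - c) * rGamma (1 + a - b - d) * rGamma (1 + a - c - d)
     * (Gamma (1 + a - b) * Gamma (1 + a - c) * Gamma (1 + a - d) * Gamma (1 + a - b - c - d)))"
    (is "_ sums ?L")
proof -
  define t where "t = (\<lambda>n k. (a + real n + 2 * real k) / (a + real n) * wp5_weight (a + real n) b c d k)"
  \<comment> \<open>\<open>\<alpha>\<close> and \<open>\<beta>\<close> are the two coefficients of
    \<open>wp5_wz\<close> with \<open>a + n\<close> in place of \<open>a\<close>.\<close>
  define \<alpha> where "\<alpha> = (\<lambda>n. (1 + a - b - c - d + real n) * ((1 + a - b + real n) * (1 + a - c + real n) * (1 + a - d + real n)))"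
  define \<beta> where "\<beta> = (\<lambda>n. (1 + a + real n) * ((1 + a - b - c + real n) * (1 + a - b - d + real n) * (1 + a - c - d + real n)))"
  have le1: "b \<le> 1" "c \<le> 1" "d \<le> 1"
    using assms(2-4) by simp_all
  with assms(1,5) have pos: "1 + a - b > 0" "1 + a - c > 0" "1 + a - d > 0" "1 + a - b - c - d > 0"
    by linarith+
  have summ: "summable (t n)" for n
    unfolding t_def by (rule summable_rabs_cancel[OF summable_wp5]) (use pos in simp_all)
  have "suminf (t 0) = ?L"
  proof (rule first_order_recurrence_limit)
    show "\<alpha> n \<noteq> 0" for n
      using pos by (auto simp: \<alpha>_def)
    show "\<alpha> n * suminf (t n) = \<beta> n * suminf (t (Suc n))" for n
    proof (rule suminf_wz)
      define a' where "a' = a + real n"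
      define G where "G = (\<lambda>k. - (1 + a' - b) * (1 + a' - c) * (1 + a' - d) / a'
        * (real k * (real k + 1 + 2 * a' - b - c - d) * wp5_weight a' b c d k))"
      have a': "a' > 0" "1 + a' - b > 0" "1 + a' - c > 0" "1 + a' - d > 0" "b + c + d < 1 + a'"
        using assms(1) pos by (simp_all add: a'_def add_pos_nonneg)
      show "\<alpha> n * t n k - \<beta> n * t (Suc n) k = G (Suc k) - G k" for k
      proof -
        have "\<alpha> n = (1 + a' - b - c - d) * ((1 + a' - b) * (1 + a' - c) * (1 + a' - d))"
          by (simp add: \<alpha>_def a'_def algebra_simps)
        moreover have "\<beta> n = (1 + a') * ((1 + a' - b - c) * (1 + a' - b - d) * (1 + a' - c - d))"
          by (simp add: \<beta>_def a'_def algebra_simps)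
        moreover have "t n k = (a' + 2 * real k) / a' * wp5_weight a' b c d k"
          by (simp add: t_def a'_def)
        moreover have "t (Suc n) k = (a' + 1 + 2 * real k) / (a' + 1) * wp5_weight (a' + 1) b c d k"
          by (simp add: t_def a'_def add_ac)
        ultimately show ?thesis
          unfolding G_def by (simp only: wp5_wz[OF a'(1-4)] right_diff_distrib[symmetric])
      qed
      \<comment> \<open>The weight has exponent \<open>2 * (b + c + d) - 2 * a' - 4\<close>, and it
        is below -2 exactly when \<open>b + c + d < 1 + a'\<close>.\<close>
      have "(\<lambda>k. (0 + (1 + 2 * a' - b - c - d) * real k + 1 * real k ^ 2) * wp5_weight a' b c d k) \<longlonglongrightarrow> 0"
        using a' by (intro quadratic_mult_bigo_tendsto_0[OF wp5_weight_bigo]) auto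
      then have "(\<lambda>k. real k * (real k + 1 + 2 * a' - b - c - d) * wp5_weight a' b c d k) \<longlonglongrightarrow> 0"
        by (simp add: algebra_simps power2_eq_square)
      then show "G \<longlonglongrightarrow> 0"
        unfolding G_def by (rule tendsto_mult_right_zero)
      show "G 0 = 0" by (simp add: G_def)
    qed (fact summ)+
    show "(\<lambda>n. suminf (t n)) \<longlonglongrightarrow> 1"
    proof (rule suminf_tendsto_1[OF _ summable_wellpoised_majorant])
      show "\<forall>\<^sub>F n in sequentially. t n 0 = 1 \<and>
          (\<forall>k>0. \<bar>t n k\<bar> \<le> 4 / (a + real n) * ((1 + 2 * real k) * (fact k / pochhammer 4 k)))"
        using eventually_ge_at_top[of 4]
      proof eventually_elim
        case (elim n)
        then have "a + real n \<ge> 4" using assms(1) by linarith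
        with wp5_term_bound[OF this assms(2-4)] show ?case
          by (simp add: t_def wp5_weight_def)
      qed
      show "(\<lambda>n. 4 / (a + real n)) \<longlonglongrightarrow> 0" by real_asymp
    qed
    show "(\<lambda>n. \<Prod>j<n. \<beta> j / \<alpha> j) \<longlonglongrightarrow> ?L"
    proof (rule Lim_transform_eventually)
      let ?q = "\<lambda>u v n. pochhammer u n / pochhammer v n * real n powr (v - u)"
      have "(\<lambda>n. ?q (1 + a) (1 + a - b - c - d) n * ?q (1 + a - b - c) (1 + a - b) n
          * (?q (1 + a - b - d) (1 + a - c) n * ?q (1 + a - c - d) (1 + a - d) n)) \<longlonglongrightarrow>
          rGamma (1 + a) / rGamma (1 + a - b - c - d) * (rGamma (1 + a - b - c) / rGamma (1 + a - b))
          * (rGamma (1 + a - b - d) / rGamma (1 + a - c) * (rGamma (1 + a - c - d) / rGamma (1 + a - d)))"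
        by (intro tendsto_mult pochhammer_quotient_asymp pos)
      then show "(\<lambda>n. ?q (1 + a) (1 + a - b - c - d) n * ?q (1 + a - b - c) (1 + a - b) n
          * (?q (1 + a - b - d) (1 + a - c) n * ?q (1 + a - c - d) (1 + a - d) n)) \<longlonglongrightarrow> ?L"
        by (simp add: Gamma_def field_simps)
      show "\<forall>\<^sub>F n in sequentially. ?q (1 + a) (1 + a - b - c - d) n * ?q (1 + a - b - c) (1 + a - b) n
          * (?q (1 + a - b - d) (1 + a - c) n * ?q (1 + a - c - d) (1 + a - d) n) = (\<Prod>j<n. \<beta> j / \<alpha> j)"
        using eventually_gt_at_top[of 0]
      proof eventually_elim
        case (elim n)
        \<comment> \<open>The arguments in the numerators and in the denominators have equal sums,
          so the powers of \<open>n\<close> cancel and the product converges.\<close>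
        have powr: "real n powr (1 + a - b - c - d - (1 + a)) * real n powr (1 + a - b - (1 + a - b - c))
           * (real n powr (1 + a - c - (1 + a - b - d)) * real n powr (1 + a - d - (1 + a - c - d))) = 1"
          unfolding powr_add[symmetric] using elim by simp
        have prod: "(\<Prod>j<n. \<beta> j / \<alpha> j) =
            pochhammer (1 + a) n / pochhammer (1 + a - b - c - d) n * (pochhammer (1 + a - b - c) n / pochhammer (1 + a - b) n)
            * (pochhammer (1 + a - b - d) n / pochhammer (1 + a - c) n * (pochhammer (1 + a - c - d) n / pochhammer (1 + a - d) n))"
          by (simp add: \<alpha>_def \<beta>_def prod_dividef prod.distrib pochhammer_prod atLeast0LessThan)
        have regroup: "(p1 * r1) * (p2 * r2) * (p3 * r3 * (p4 * r4)) = p1 * p2 * (p3 * p4)"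
          if "r1 * r2 * (r3 * r4) = 1" for p1 p2 p3 p4 r1 r2 r3 r4 :: real
          using that by algebra
        show ?case unfolding prod by (rule regroup[OF powr])
      qed
    qed
  qed
  with summable_sums[OF summ[of 0]] show ?thesis
    by (simp add: t_def)
qed

text \<open>Same argument with the degenerate certificate. The condition
  \<open>2 * (b + c) < 1 + a\<close> is what puts the exponent in \<open>wp4_weight_bigo\<close>
  below -2, giving absolute convergence.\<close>

theorem well_poised_4F3_sums:
  assumes "a > 0" "\<bar>b\<bar> \<le> 1" "\<bar>c\<bar> \<le> 1" "2 * (b + c) < 1 + a"
  shows "(\<lambda>k. (a + 2 * real k) / a * wp4_weight a b c k) sums
    (rGamma (1 + a) * rGamma (1 + a - b - c) * (Gamma (1 + a - b) * Gamma (1 + a - c)))"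
    (is "_ sums ?L")
proof -
  define t where "t = (\<lambda>n k. (a + real n + 2 * real k) / (a + real n) * wp4_weight (a + real n) b c k)"
  define \<alpha> where "\<alpha> = (\<lambda>n. (1 + a - b + real n) * (1 + a - c + real n))"
  define \<beta> where "\<beta> = (\<lambda>n. (1 + a + real n) * (1 + a - b - c + real n))"
  have le1: "b \<le> 1" "c \<le> 1"
    using assms(2,3) by simp_all
  with assms(1) have pos: "1 + a - b > 0" "1 + a - c > 0"
    by linarith+
  have summ: "summable (t n)" for n
    unfolding t_def by (rule summable_rabs_cancel[OF summable_wp4]) (use pos assms(4) in simp_all)
  have "suminf (t 0) = ?L"
  proof (rule first_order_recurrence_limit)
    show "\<alpha> n \<noteq> 0" for n
      using pos by (auto simp: \<alpha>_def)
    show "\<alpha> n * suminf (t n) = \<beta> n * suminf (t (Suc n))" for n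
    proof (rule suminf_wz)
      define a' where "a' = a + real n"
      define G where "G = (\<lambda>k. - (1 + a' - b) * (1 + a' - c) / a' * (real k * wp4_weight a' b c k))"
      have a': "a' > 0" "1 + a' - b > 0" "1 + a' - c > 0" "2 * (b + c) < 1 + a'"
        using assms(1,4) pos by (simp_all add: a'_def add_pos_nonneg)
      show "\<alpha> n * t n k - \<beta> n * t (Suc n) k = G (Suc k) - G k" for k
      proof -
        have "\<alpha> n = (1 + a' - b) * (1 + a' - c)"
          by (simp add: \<alpha>_def a'_def algebra_simps)
        moreover have "\<beta> n = (1 + a') * (1 + a' - b - c)"
          by (simp add: \<beta>_def a'_def algebra_simps)
        moreover have "t n k = (a' + 2 * real k) / a' * wp4_weight a' b c k"
          by (simp add: t_def a'_def)
        moreover have "t (Suc n) k = (a' + 1 + 2 * real k) / (a' + 1) * wp4_weight (a' + 1) b c k"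
          by (simp add: t_def a'_def add_ac)
        ultimately show ?thesis
          unfolding G_def by (simp only: wp4_wz[OF a'(1-3)] right_diff_distrib[symmetric])
      qed
      have "(\<lambda>k. (0 + 1 * real k + 0 * real k ^ 2) * wp4_weight a' b c k) \<longlonglongrightarrow> 0"
        using a' by (intro quadratic_mult_bigo_tendsto_0[OF wp4_weight_bigo]) auto
      then have "(\<lambda>k. real k * wp4_weight a' b c k) \<longlonglongrightarrow> 0"
        by simp
      then show "G \<longlonglongrightarrow> 0"
        unfolding G_def by (rule tendsto_mult_right_zero)
      show "G 0 = 0" by (simp add: G_def)
    qed (fact summ)+
    show "(\<lambda>n. suminf (t n)) \<longlonglongrightarrow> 1"
    proof (rule suminf_tendsto_1[OF _ summable_wellpoised_majorant])
      show "\<forall>\<^sub>F n in sequentially. t n 0 = 1 \<and>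
          (\<forall>k>0. \<bar>t n k\<bar> \<le> 4 / (a + real n) * ((1 + 2 * real k) * (fact k / pochhammer 4 k)))"
        using eventually_ge_at_top[of 4]
      proof eventually_elim
        case (elim n)
        then have "a + real n \<ge> 4" using assms(1) by linarith
        with wp4_term_bound[OF this assms(2-3)] show ?case
          by (simp add: t_def wp4_weight_def)
      qed
      show "(\<lambda>n. 4 / (a + real n)) \<longlonglongrightarrow> 0" by real_asymp
    qed
    show "(\<lambda>n. \<Prod>j<n. \<beta> j / \<alpha> j) \<longlonglongrightarrow> ?L"
    proof (rule Lim_transform_eventually)
      let ?q = "\<lambda>u v n. pochhammer u n / pochhammer v n * real n powr (v - u)"
      have "(\<lambda>n. ?q (1 + a) (1 + a - b) n * ?q (1 + a - b - c) (1 + a - c) n) \<longlonglongrightarrow>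
          rGamma (1 + a) / rGamma (1 + a - b) * (rGamma (1 + a - b - c) / rGamma (1 + a - c))"
        by (intro tendsto_mult pochhammer_quotient_asymp pos)
      then show "(\<lambda>n. ?q (1 + a) (1 + a - b) n * ?q (1 + a - b - c) (1 + a - c) n) \<longlonglongrightarrow> ?L"
        by (simp add: Gamma_def field_simps)
      show "\<forall>\<^sub>F n in sequentially. ?q (1 + a) (1 + a - b) n * ?q (1 + a - b - c) (1 + a - c) n
          = (\<Prod>j<n. \<beta> j / \<alpha> j)"
        using eventually_gt_at_top[of 0]
      proof eventually_elim
        case (elim n)
        have powr: "real n powr (1 + a - b - (1 + a)) * real n powr (1 + a - c - (1 + a - b - c)) = 1"
          unfolding powr_add[symmetric] using elim by simp
        have prod: "(\<Prod>j<n. \<beta> j / \<alpha> j) =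
            pochhammer (1 + a) n / pochhammer (1 + a - b) n * (pochhammer (1 + a - b - c) n / pochhammer (1 + a - c) n)"
          by (simp add: \<alpha>_def \<beta>_def prod_dividef prod.distrib pochhammer_prod atLeast0LessThan)
        have regroup: "(p1 * r1) * (p2 * r2) = p1 * p2" if "r1 * r2 = 1" for p1 p2 r1 r2 :: real
          using that by algebra
        show ?case unfolding prod by (rule regroup[OF powr])
      qed
    qed
  qed
  with summable_sums[OF summ[of 0]] show ?thesis
    by (simp add: t_def)
qed

section \<open>The second-order coefficient\<close>

lemma rGamma_reflection_real:
  "rGamma x * rGamma (1 - x) = sin (pi * x) / (pi::real)"
proof -
  have "complex_of_real (rGamma x * rGamma (1 - x)) = of_real (sin (pi * x) / pi)"
    using rGamma_reflection_complex[of "of_real x"]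
    by (simp add: rGamma_complex_of_real[symmetric] sin_of_real[symmetric])
  then show ?thesis by (simp only: of_real_eq_iff)
qed

lemma rGamma_half_pm:
  "rGamma (1/2 - x) * rGamma (1/2 + x) = cos (pi * x) / (pi::real)"
proof -
  have "sin (pi * (1/2 - x)) = cos (pi * x)"
    by (simp add: right_diff_distrib sin_diff)
  then show ?thesis
    using rGamma_reflection_real[of "1/2 - x"] by simp
qed

text \<open>One step of the functional equation in each factor reduces to
  \<open>rGamma_half_pm\<close>, at the cost of \<open>(1/2 - x) * (1/2 + x)\<close>.\<close>

lemma rGamma_three_halves_pm:
  fixes x :: real
  assumes "\<bar>x\<bar> < 1/2"
  shows "rGamma (3/2 - x) * rGamma (3/2 + x) = cos (pi * x) / (pi * (1/4 - x\<^sup>2))"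
proof -
  have "(1/4 - x\<^sup>2) * (rGamma (3/2 - x) * rGamma (3/2 + x)) = rGamma (1/2 - x) * rGamma (1/2 + x)"
    using rGamma_plus1[of "1/2 - x"] rGamma_plus1[of "1/2 + x"]
    by (simp add: algebra_simps power2_eq_square) algebra
  moreover have "1/4 - x\<^sup>2 \<noteq> 0"
    using assms abs_square_less_1[of "2 * x"] by (auto simp: power2_eq_square)
  ultimately show ?thesis
    unfolding rGamma_half_pm by (simp add: field_simps)
qed

lemma rGamma_five_halves_pm:
  fixes x :: real
  assumes "\<bar>x\<bar> < 1/2"
  shows "rGamma (5/2 - x) * rGamma (5/2 + x) = cos (pi * x) / (pi * (1/4 - x\<^sup>2) * (9/4 - x\<^sup>2))"
proof -
  have eq: "rGamma (5/2 - x) * rGamma (5/2 + x) * (9/4 - x\<^sup>2) = rGamma (3/2 - x) * rGamma (3/2 + x)"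
    using rGamma_plus1[of "3/2 - x"] rGamma_plus1[of "3/2 + x"]
    by (simp add: algebra_simps power2_eq_square) algebra
  have nz: "9/4 - x\<^sup>2 \<noteq> 0"
    using assms abs_square_less_1[of "2 * x"] by (auto simp: power2_eq_square)
  have "rGamma (5/2 - x) * rGamma (5/2 + x)
      = rGamma (3/2 - x) * rGamma (3/2 + x) / (9/4 - x\<^sup>2)"
    by (rule eq_divide_imp[OF nz eq])
  then show ?thesis
    by (simp only: rGamma_three_halves_pm[OF assms] divide_divide_eq_left)
qed

text \<open>Reflection at \<open>x\<close>, with \<open>rGamma x\<close> rewritten through
  \<open>1 + x\<close>. The point \<open>x = 0\<close> is excluded because the quotient by the sine
  is 0 there by convention, whereas the product is 1.\<close>

lemma Gamma_one_pm:
  fixes x :: real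
  assumes "0 < x" "x < 1/2"
  shows "Gamma (1 - x) * Gamma (1 + x) = pi * x / sin (pi * x)"
proof -
  have "rGamma (1 - x) * rGamma (1 + x) = sin (pi * x) / (pi * x)"
    using rGamma_reflection_real[of x] rGamma_plus1[of x, symmetric] assms
    by (simp add: field_simps)
  then show ?thesis
    by (simp add: Gamma_def field_simps)
qed

lemma Gamma_two_pm:
  fixes x :: real
  assumes "0 < x" "x < 1/2"
  shows "Gamma (2 - x) * Gamma (2 + x) = (1 - x\<^sup>2) * (pi * x / sin (pi * x))"
proof -
  have "1 - x \<notin> \<int>\<^sub>\<le>\<^sub>0" "1 + x \<notin> \<int>\<^sub>\<le>\<^sub>0"
    using assms by (auto elim!: nonpos_Ints_cases)
  then have "Gamma (2 - x) = (1 - x) * Gamma (1 - x)" "Gamma (2 + x) = (1 + x) * Gamma (1 + x)"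
    using Gamma_plus1[of "1 - x"] Gamma_plus1[of "1 + x"] by (simp_all add: add.commute)
  then show ?thesis
    unfolding Gamma_one_pm[OF assms, symmetric] by algebra
qed

section \<open>Termwise extraction of the \<open>x^2\<close> coefficient\<close>

lemma pochhammer_pm:
  fixes p x :: real
  assumes "p > 0"
  shows "pochhammer (p + x) k * pochhammer (p - x) k = pochhammer p k ^ 2 * (\<Prod>i<k. 1 - x\<^sup>2 / (p + real i)\<^sup>2)"
proof -
  have "p + real i \<noteq> 0" for i using assms by linarith
  then have "(p + x + real i) * (p - x + real i) = (p + real i)\<^sup>2 * (1 - x\<^sup>2 / (p + real i)\<^sup>2)" for i
    by (simp add: right_diff_distrib) (simp add: power2_eq_square algebra_simps)
  then show ?thesis
    by (simp add: pochhammer_prod atLeast0LessThan prod.distrib[symmetric] prod_power_distrib)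
qed

text \<open>Weierstrass's product inequality; it bounds the defect of a product independently of its
  length once the defects of the factors are summable.\<close>

lemma one_minus_prod_le_sum:
  fixes q :: "nat \<Rightarrow> real"
  assumes "\<And>i. 0 \<le> q i" "\<And>i. q i \<le> 1"
  shows "1 - (\<Prod>i<k. q i) \<le> (\<Sum>i<k. 1 - q i)"
proof (induction k)
  case (Suc k)
  have "(\<Prod>i<k. q i) \<le> 1" using assms by (intro prod_le_1) auto
  then have "(\<Prod>i<k. q i) * (1 - q k) \<le> 1 * (1 - q k)"
    using assms by (intro mult_right_mono) auto
  with Suc show ?case by (simp add: algebra_simps)
qed simp

text \<open>In \<open>y = x^2\<close> the product has value 1 and derivative the harmonic sum at 0.
  Since \<open>m \<ge> 1/2\<close>, all its factors lie in \<open>[0, 1]\<close>, so the difference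
  quotients are bounded by one constant \<open>C\<close> for all \<open>k\<close>, and Tannery's
  theorem exchanges limit and sum.\<close>

lemma sums_second_order_coefficient:
  fixes v :: "nat \<Rightarrow> real" and R :: "real \<Rightarrow> real"
  assumes m: "m \<ge> 1/2" and v: "summable (\<lambda>k. \<bar>v k\<bar>)" "v sums R\<^sub>0"
    and R: "\<And>x. 0 < x \<Longrightarrow> x < 1/2 \<Longrightarrow>
      (\<lambda>k. v k * (\<Prod>i<k. (1 - x\<^sup>2 / (1/2 + real i)\<^sup>2) / (1 - x\<^sup>2 / (m + real i)\<^sup>2))) sums R x"
    and L: "((\<lambda>x. (R x - R\<^sub>0) / x\<^sup>2) \<longlongrightarrow> L) (at_right 0)"
  shows "(\<lambda>k. v k * (\<Sum>i<k. 1 / (m + real i)\<^sup>2 - 1 / (1/2 + real i)\<^sup>2)) sums L"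
proof -
  define q where "q = (\<lambda>i y. (1 - y / (1/2 + real i)\<^sup>2) / (1 - y / (m + real i)\<^sup>2))"
  define H where "H = (\<lambda>k. \<Sum>i<k. 1 / (m + real i)\<^sup>2 - 1 / (1/2 + real i)\<^sup>2)"
  define C where "C = (\<Sum>i. 1 / (1/2 + real i)\<^sup>2)"
  define t where "t = (\<lambda>k x. v k * (((\<Prod>i<k. q i (x\<^sup>2)) - 1) / x\<^sup>2))"
  have C: "summable (\<lambda>i. 1 / (1/2 + real i)\<^sup>2)"
  proof (rule summable_comparison_test_bigo)
    show "(\<lambda>i. 1 / (1/2 + real i)\<^sup>2) \<in> O(\<lambda>i. real i powr (-2))"
      by real_asymp
    show "summable (\<lambda>i. norm (real i powr (-2)))"
      by (simp add: summable_real_powr_iff)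
  qed
  have small: "\<forall>\<^sub>F x in at_right 0. 0 < x \<and> x < (1/2::real)"
    unfolding eventually_at_right_field by (intro exI[of _ "1/2"]) auto
  have bound: "\<bar>((\<Prod>i<k. q i (x\<^sup>2)) - 1) / x\<^sup>2\<bar> \<le> C" if x: "0 < x" "x < 1/2" for k x
  proof -
    have le1: "x\<^sup>2 / (1/2 + real i)\<^sup>2 < 1" for i
      using x by (simp add: power_strict_mono)
    have le: "x\<^sup>2 / (m + real i)\<^sup>2 \<le> x\<^sup>2 / (1/2 + real i)\<^sup>2" for i
      using m x by (intro divide_left_mono power_mono mult_pos_pos) auto
    have nn: "0 \<le> x\<^sup>2 / (m + real i)\<^sup>2" for i by simp
    have q: "0 \<le> q i (x\<^sup>2)" "q i (x\<^sup>2) \<le> 1" "1 - q i (x\<^sup>2) \<le> x\<^sup>2 * (1 / (1/2 + real i)\<^sup>2)" for i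
    proof -
      define u w where "u = x\<^sup>2 / (1/2 + real i)\<^sup>2" and "w = x\<^sup>2 / (m + real i)\<^sup>2"
      have uw: "u < 1" "w \<le> u" "0 \<le> w"
        using le1[of i] le[of i] nn[of i] by (auto simp: u_def w_def)
      \<comment> \<open>This is the bound \<open>1 - (1 - u) / (1 - w) \<le> u\<close> after
        clearing the denominator.\<close>
      then have "(1 - u) * w \<ge> 0" by simp
      with uw have "0 \<le> (1 - u) / (1 - w)" "(1 - u) / (1 - w) \<le> 1" "1 - (1 - u) / (1 - w) \<le> u"
        by (auto simp: field_simps)
      then show "0 \<le> q i (x\<^sup>2)" "q i (x\<^sup>2) \<le> 1" "1 - q i (x\<^sup>2) \<le> x\<^sup>2 * (1 / (1/2 + real i)\<^sup>2)"
        by (auto simp: q_def u_def w_def)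
    qed
    have "1 - (\<Prod>i<k. q i (x\<^sup>2)) \<le> (\<Sum>i<k. 1 - q i (x\<^sup>2))"
      by (rule one_minus_prod_le_sum[OF q(1,2)])
    also have "\<dots> \<le> (\<Sum>i<k. x\<^sup>2 * (1 / (1/2 + real i)\<^sup>2))"
      by (intro sum_mono q)
    also have "\<dots> = x\<^sup>2 * (\<Sum>i<k. 1 / (1/2 + real i)\<^sup>2)"
      by (rule sum_distrib_left[symmetric])
    also have "\<dots> \<le> x\<^sup>2 * C"
      unfolding C_def by (intro mult_left_mono sum_le_suminf C) auto
    finally have "1 - (\<Prod>i<k. q i (x\<^sup>2)) \<le> x\<^sup>2 * C" .
    moreover have "(\<Prod>i<k. q i (x\<^sup>2)) \<le> 1"
      using q by (intro prod_le_1) auto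
    ultimately show ?thesis
      using x by (simp add: abs_le_iff field_simps)
  qed
  have "eventually (\<lambda>x. summable (\<lambda>k. norm (t k x))) (at_right 0) \<and> summable (\<lambda>k. norm (v k * H k))
      \<and> ((\<lambda>x. \<Sum>k. t k x) \<longlongrightarrow> (\<Sum>k. v k * H k)) (at_right 0)"
  proof (rule tannerys_theorem)
    show "((\<lambda>x. t k x) \<longlongrightarrow> v k * H k) (at_right 0)" for k
    proof -
      \<comment> \<open>Every factor \<open>q i\<close> equals 1 at 0, so the logarithmic derivative
        of the product there is \<open>H k\<close>.\<close>
      have "((\<lambda>y. \<Prod>i<k. q i y) has_field_derivative
          ((\<Prod>i<k. q i 0) * (\<Sum>i<k. (1 / (m + real i)\<^sup>2 - 1 / (1/2 + real i)\<^sup>2) / q i 0))) (at 0)"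
      proof (rule has_field_derivative_prod')
        show "q i 0 \<noteq> 0" for i by (simp add: q_def)
        show "(q i has_field_derivative 1 / (m + real i)\<^sup>2 - 1 / (1/2 + real i)\<^sup>2) (at 0)" for i
        proof -
          have "((\<lambda>y. (1 - y / A) / (1 - y / B)) has_field_derivative 1 / B - 1 / A) (at 0)"
            if "A \<noteq> 0" "B \<noteq> 0" for A B :: real
            using that by (auto intro!: derivative_eq_intros)
          from this[of "(1/2 + real i)\<^sup>2" "(m + real i)\<^sup>2"] show ?thesis
            using m by (simp add: q_def)
        qed
      qed
      then have "((\<lambda>y. \<Prod>i<k. q i y) has_field_derivative H k) (at 0)"
        by (simp add: q_def H_def)
      then have "((\<lambda>y. ((\<Prod>i<k. q i y) - 1) / y) \<longlongrightarrow> H k) (at 0)"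
        by (simp add: DERIV_def q_def)
      \<comment> \<open>The square approaches 0 through nonzero values, so \<open>x^2\<close> may be
        substituted in the punctured limit.\<close>
      moreover have "filterlim (\<lambda>x::real. x\<^sup>2) (at 0) (at_right 0)"
        by real_asymp
      ultimately show ?thesis
        unfolding t_def by (intro tendsto_mult_left) (rule filterlim_compose)
    qed
    show "eventually (\<lambda>(k, x). norm (t k x) \<le> \<bar>v k\<bar> * C) (at_top \<times>\<^sub>F at_right 0)"
    proof -
      have "eventually (\<lambda>(k::nat, x). 0 < x \<and> x < (1/2::real)) (at_top \<times>\<^sub>F at_right 0)"
        using small by (subst eventually_prod2) auto
      then show ?thesis
      proof (rule eventually_mono, clarify)
        fix k :: nat and x :: real
        assume x: "0 < x" "x < 1/2"
        show "norm (t k x) \<le> \<bar>v k\<bar> * C"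
          unfolding t_def real_norm_def abs_mult[of "v k"]
          by (intro mult_left_mono bound[OF x]) simp
      qed
    qed
    show "summable (\<lambda>k. \<bar>v k\<bar> * C)"
      by (rule summable_mult2[OF v(1)])
  qed simp
  moreover have "((\<lambda>x. \<Sum>k. t k x) \<longlongrightarrow> L) (at_right 0)"
  proof (rule Lim_transform_eventually[OF L])
    show "\<forall>\<^sub>F x in at_right 0. (R x - R\<^sub>0) / x\<^sup>2 = (\<Sum>k. t k x)"
      using small
    proof eventually_elim
      case (elim x)
      have "(\<lambda>k. (v k * (\<Prod>i<k. q i (x\<^sup>2)) - v k) / x\<^sup>2) sums ((R x - R\<^sub>0) / x\<^sup>2)"
        unfolding q_def by (intro sums_divide sums_diff R v(2)) (use elim in auto)
      then show ?case
        by (simp add: t_def sums_iff right_diff_distrib)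
    qed
  qed
  ultimately have "summable (\<lambda>k. v k * H k)" "(\<Sum>k. v k * H k) = L"
    using tendsto_unique[OF trivial_limit_at_right_real] by (auto intro: summable_norm_cancel)
  then show ?thesis by (simp add: sums_iff H_def)
qed

lemma wp5_weight_pm:
  assumes "m = a + 1/2" "m > 0"
  shows "wp5_weight a b (1/2 + x) (1/2 - x) k = wp5_weight a b (1/2) (1/2) k
    * (\<Prod>i<k. (1 - x\<^sup>2 / (1/2 + real i)\<^sup>2) / (1 - x\<^sup>2 / (m + real i)\<^sup>2))"
proof -
  have sub: "1 + a - (1/2 + x) = m - x" "1 + a - (1/2 - x) = m + x" "1 + a - 1/2 = m"
    using assms(1) by simp_all
  have "wp5_weight a b (1/2 + x) (1/2 - x) k
      = pochhammer a k * pochhammer b k * (pochhammer (1/2 + x) k * pochhammer (1/2 - x) k)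
        / (fact k * pochhammer (1 + a - b) k * (pochhammer (m + x) k * pochhammer (m - x) k))"
    by (simp only: wp5_weight_def sub mult_ac)
  also have "\<dots> = wp5_weight a b (1/2) (1/2) k
    * (\<Prod>i<k. (1 - x\<^sup>2 / (1/2 + real i)\<^sup>2) / (1 - x\<^sup>2 / (m + real i)\<^sup>2))"
    unfolding pochhammer_pm[OF assms(2)] pochhammer_pm[OF half_gt_zero[OF zero_less_one]] wp5_weight_def sub
    by (simp add: prod_dividef power2_eq_square mult_ac)
  finally show ?thesis .
qed

lemma wp4_weight_pm:
  assumes "m = a + 1/2" "m > 0"
  shows "wp4_weight a (1/2 + x) (1/2 - x) k = wp4_weight a (1/2) (1/2) k
    * (\<Prod>i<k. (1 - x\<^sup>2 / (1/2 + real i)\<^sup>2) / (1 - x\<^sup>2 / (m + real i)\<^sup>2))"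
proof -
  have sub: "1 + a - (1/2 + x) = m - x" "1 + a - (1/2 - x) = m + x" "1 + a - 1/2 = m"
    using assms(1) by simp_all
  have "wp4_weight a (1/2 + x) (1/2 - x) k
      = (-1) ^ k * pochhammer a k * (pochhammer (1/2 + x) k * pochhammer (1/2 - x) k)
        / (fact k * (pochhammer (m + x) k * pochhammer (m - x) k))"
    by (simp only: wp4_weight_def sub mult_ac)
  also have "\<dots> = wp4_weight a (1/2) (1/2) k
    * (\<Prod>i<k. (1 - x\<^sup>2 / (1/2 + real i)\<^sup>2) / (1 - x\<^sup>2 / (m + real i)\<^sup>2))"
    unfolding pochhammer_pm[OF assms(2)] pochhammer_pm[OF half_gt_zero[OF zero_less_one]] wp4_weight_def sub
    by (simp add: prod_dividef power2_eq_square mult_ac)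
  finally show ?thesis .
qed

section \<open>Harmonic series at the special parameters\<close>

text \<open>Dougall's sum at \<open>c, d = 1/2 \<plusminus> x\<close>: \<open>K\<close> collects the
  Gamma factors free of \<open>x\<close>, and \<open>P\<close> and \<open>Q\<close> are the even
  ones. Convergence amounts to \<open>b < a\<close>. The value at \<open>x = 0\<close> uses
  \<open>P 0\<close> and \<open>Gamma m = 1\<close>, so that \<open>Q\<close>, a quotient by a sine
  in the applications, is never evaluated at 0.\<close>

lemma wp5_harmonic_sums:
  assumes "a > 0" "\<bar>b\<bar> \<le> 1" "b < a" "m = a + 1/2"
    and K: "rGamma (1 + a) * rGamma a * (Gamma (1 + a - b) * Gamma (a - b)) = K"
    and P: "\<And>x. 0 \<le> x \<Longrightarrow> x < 1/2 \<Longrightarrow> rGamma (m - b - x) * rGamma (m - b + x) = P x"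
    and Q: "\<And>x. 0 < x \<Longrightarrow> x < 1/2 \<Longrightarrow> Gamma (m - x) * Gamma (m + x) = Q x"
    and "Gamma m = 1"
    and L: "((\<lambda>x. (K * P x * Q x - K * P 0) / x\<^sup>2) \<longlongrightarrow> L) (at_right 0)"
  shows "(\<lambda>k. (a + 2 * real k) / a * wp5_weight a b (1/2) (1/2) k
     * (\<Sum>i<k. 1 / (m + real i)\<^sup>2 - 1 / (1/2 + real i)\<^sup>2)) sums L"
proof (rule sums_second_order_coefficient[OF _ _ _ _ L])
  have ab: "1 + a - b > 0" using assms(3) by simp
  have sums: "(\<lambda>k. (a + 2 * real k) / a * wp5_weight a b (1/2 + x) (1/2 - x) k) sums
      (rGamma (1 + a) * rGamma a * (Gamma (1 + a - b) * Gamma (a - b))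
       * (rGamma (m - b - x) * rGamma (m - b + x)) * (Gamma (m - x) * Gamma (m + x)))"
    if "0 \<le> x" "x < 1/2" for x
  proof -
    have args: "1 + a - b - (1/2 + x) = m - b - x" "1 + a - b - (1/2 - x) = m - b + x"
      "1 + a - (1/2 + x) - (1/2 - x) = a" "1 + a - (1/2 + x) = m - x" "1 + a - (1/2 - x) = m + x"
      "m - b - x - (1/2 - x) = a - b" "m - x - (1/2 - x) = a"
      using assms(4) by simp_all
    have "(\<lambda>k. (a + 2 * real k) / a * wp5_weight a b (1/2 + x) (1/2 - x) k) sums
      (rGamma (1 + a) * rGamma (m - b - x) * rGamma (m - b + x) * rGamma a
       * (Gamma (1 + a - b) * Gamma (m - x) * Gamma (m + x) * Gamma (a - b)))"
      using well_poised_5F4_sums[of a b "1/2 + x" "1/2 - x", unfolded args] assms(1-3) that by simp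
    then show ?thesis
      by (simp only: mult_ac)
  qed
  show "m \<ge> 1/2" using assms(1,4) by simp
  show "(\<lambda>k. (a + 2 * real k) / a * wp5_weight a b (1/2) (1/2) k) sums (K * P 0)"
    using sums[of 0, unfolded K] P[of 0] assms(8) by simp
  show "summable (\<lambda>k. \<bar>(a + 2 * real k) / a * wp5_weight a b (1/2) (1/2) k\<bar>)"
    by (rule summable_wp5) (use ab assms in simp_all)
  show "(\<lambda>k. (a + 2 * real k) / a * wp5_weight a b (1/2) (1/2) k
      * (\<Prod>i<k. (1 - x\<^sup>2 / (1/2 + real i)\<^sup>2) / (1 - x\<^sup>2 / (m + real i)\<^sup>2))) sums (K * P x * Q x)"
    if "0 < x" "x < 1/2" for x
    using sums[of x, unfolded K P[OF less_imp_le[OF that(1)] that(2)] Q[OF that]] that assms(1,4) by (simp add: wp5_weight_pm[of m] mult.assoc)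
qed

text \<open>Here \<open>b + c = 1\<close>, so the convergence condition of the 4F3 sum becomes
  \<open>a > 1\<close>.\<close>

lemma wp4_harmonic_sums:
  assumes "a > 1" "m = a + 1/2"
    and K: "rGamma (1 + a) * rGamma a = K"
    and Q: "\<And>x. 0 < x \<Longrightarrow> x < 1/2 \<Longrightarrow> Gamma (m - x) * Gamma (m + x) = Q x"
    and "Gamma m = 1"
    and L: "((\<lambda>x. (K * Q x - K) / x\<^sup>2) \<longlongrightarrow> L) (at_right 0)"
  shows "(\<lambda>k. (a + 2 * real k) / a * wp4_weight a (1/2) (1/2) k
     * (\<Sum>i<k. 1 / (m + real i)\<^sup>2 - 1 / (1/2 + real i)\<^sup>2)) sums L"
proof (rule sums_second_order_coefficient[OF _ _ _ _ L])
  have sums: "(\<lambda>k. (a + 2 * real k) / a * wp4_weight a (1/2 + x) (1/2 - x) k) sums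
      (rGamma (1 + a) * rGamma a * (Gamma (m - x) * Gamma (m + x)))"
    if "0 \<le> x" "x < 1/2" for x
  proof -
    have args: "1 + a - (1/2 + x) = m - x" "1 + a - (1/2 - x) = m + x" "m - x - (1/2 - x) = a"
      using assms(2) by simp_all
    show ?thesis
      using well_poised_4F3_sums[of a "1/2 + x" "1/2 - x", unfolded args] assms(1) that by simp
  qed
  show "m \<ge> 1/2" using assms by simp
  show "(\<lambda>k. (a + 2 * real k) / a * wp4_weight a (1/2) (1/2) k) sums K"
    using sums[of 0, unfolded K] assms(5) by simp
  show "summable (\<lambda>k. \<bar>(a + 2 * real k) / a * wp4_weight a (1/2) (1/2) k\<bar>)"
    by (rule summable_wp4) (use assms in simp_all)
  show "(\<lambda>k. (a + 2 * real k) / a * wp4_weight a (1/2) (1/2) k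
      * (\<Prod>i<k. (1 - x\<^sup>2 / (1/2 + real i)\<^sup>2) / (1 - x\<^sup>2 / (m + real i)\<^sup>2))) sums (K * Q x)"
    if "0 < x" "x < 1/2" for x
    using sums[of x, unfolded K Q[OF that]] that assms(1,2) by (simp add: wp4_weight_pm[of m] mult.assoc)
qed

lemma rGamma_half_squared: "rGamma (1/2) * rGamma (1/2) = 1 / (pi::real)"
  using rGamma_half_pm[of 0] by simp

lemma rGamma_half_integer:
  "rGamma (3/2 :: real) = 2 * rGamma (1/2)" "rGamma (5/2 :: real) = 4/3 * rGamma (1/2)"
  using rGamma_plus1[of "1/2 :: real"] rGamma_plus1[of "3/2 :: real"] by simp_all

text \<open>The value at \<open>x = 0\<close> is \<open>8 / pi^2\<close>. The relative
  \<open>x^2\<close> coefficient gets 4 from \<open>1/4 - x^2\<close>, \<open>- pi^2 / 2\<close>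
  from the cosine and \<open>pi^2 / 6\<close> from the sine quotient.\<close>

lemma wp5_harmonic_sum_half_neg_half:
  "(\<lambda>k. (1/2 + 2 * real k) / (1/2) * wp5_weight (1/2) (-1/2) (1/2) (1/2) k
     * (\<Sum>i<k. 1 / (1 + real i)\<^sup>2 - 1 / (1/2 + real i)\<^sup>2)) sums (32 / pi\<^sup>2 - 8/3)"
proof (rule wp5_harmonic_sums)
  show "rGamma (1 + 1/2) * rGamma (1/2) * (Gamma (1 + 1/2 - (-1/2)) * Gamma (1/2 - (-1/2))) = 2 / pi"
    using rGamma_half_squared Gamma_numeral[of "num.Bit0 num.One", where ?'a = real]
    by (simp add: rGamma_half_integer)
  show "rGamma (1 - (-1/2) - x) * rGamma (1 - (-1/2) + x) = cos (pi * x) / (pi * (1/4 - x\<^sup>2))"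
    if "0 \<le> x" "x < 1/2" for x
    using rGamma_three_halves_pm[of x] that by simp
  show "((\<lambda>x. (2 / pi * (cos (pi * x) / (pi * (1/4 - x\<^sup>2))) * (pi * x / sin (pi * x))
       - 2 / pi * (cos (pi * 0) / (pi * (1/4 - 0\<^sup>2)))) / x\<^sup>2)
     \<longlongrightarrow> 32 / pi\<^sup>2 - 8/3) (at_right 0)"
    by (real_asymp, simp add: field_simps power2_eq_square)
qed (simp_all add: Gamma_one_pm)

text \<open>The rational part is \<open>4 + 4/9 - 1 = 31/9\<close>, from \<open>1/4 - x^2\<close>,
  \<open>9/4 - x^2\<close> and \<open>1 - x^2\<close>; the trigonometric part is again
  \<open>- pi^2 / 3\<close>.\<close>

lemma wp5_harmonic_sum_three_halves_neg_half:
  "(\<lambda>k. (3/2 + 2 * real k) / (3/2) * wp5_weight (3/2) (-1/2) (1/2) (1/2) k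
     * (\<Sum>i<k. 1 / (2 + real i)\<^sup>2 - 1 / (1/2 + real i)\<^sup>2)) sums (256 / (27 * pi\<^sup>2) * (31/9 - pi\<^sup>2 / 3))"
proof (rule wp5_harmonic_sums)
  show "rGamma (1 + 3/2) * rGamma (3/2) * (Gamma (1 + 3/2 - (-1/2)) * Gamma (3/2 - (-1/2))) = 16 / (3 * pi)"
    using rGamma_half_squared
    by (simp add: rGamma_half_integer Gamma_numeral numeral_3_eq_3)
  show "rGamma (2 - (-1/2) - x) * rGamma (2 - (-1/2) + x) = cos (pi * x) / (pi * (1/4 - x\<^sup>2) * (9/4 - x\<^sup>2))"
    if "0 \<le> x" "x < 1/2" for x
    using rGamma_five_halves_pm[of x] that by simp
  show "Gamma 2 = (1::real)" by (simp add: Gamma_numeral)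
  show "((\<lambda>x. (16 / (3 * pi) * (cos (pi * x) / (pi * (1/4 - x\<^sup>2) * (9/4 - x\<^sup>2)))
         * ((1 - x\<^sup>2) * (pi * x / sin (pi * x)))
       - 16 / (3 * pi) * (cos (pi * 0) / (pi * (1/4 - 0\<^sup>2) * (9/4 - 0\<^sup>2)))) / x\<^sup>2)
     \<longlongrightarrow> 256 / (27 * pi\<^sup>2) * (31/9 - pi\<^sup>2 / 3)) (at_right 0)"
    by (real_asymp, simp add: field_simps power2_eq_square)
qed (simp_all add: Gamma_two_pm)

lemma wp5_harmonic_sum_three_halves_half:
  "(\<lambda>k. (3/2 + 2 * real k) / (3/2) * wp5_weight (3/2) (1/2) (1/2) (1/2) k
     * (\<Sum>i<k. 1 / (2 + real i)\<^sup>2 - 1 / (1/2 + real i)\<^sup>2)) sums (32 / (3 * pi\<^sup>2) * (3 - pi\<^sup>2 / 3))"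
proof (rule wp5_harmonic_sums)
  show "rGamma (1 + 3/2) * rGamma (3/2) * (Gamma (1 + 3/2 - 1/2) * Gamma (3/2 - 1/2)) = 8 / (3 * pi)"
    using rGamma_half_squared
    by (simp add: rGamma_half_integer Gamma_numeral)
  show "rGamma (2 - 1/2 - x) * rGamma (2 - 1/2 + x) = cos (pi * x) / (pi * (1/4 - x\<^sup>2))"
    if "0 \<le> x" "x < 1/2" for x
    using rGamma_three_halves_pm[of x] that by simp
  show "Gamma 2 = (1::real)" by (simp add: Gamma_numeral)
  show "((\<lambda>x. (8 / (3 * pi) * (cos (pi * x) / (pi * (1/4 - x\<^sup>2)))
         * ((1 - x\<^sup>2) * (pi * x / sin (pi * x)))
       - 8 / (3 * pi) * (cos (pi * 0) / (pi * (1/4 - 0\<^sup>2)))) / x\<^sup>2)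
     \<longlongrightarrow> 32 / (3 * pi\<^sup>2) * (3 - pi\<^sup>2 / 3)) (at_right 0)"
    by (real_asymp, simp add: field_simps power2_eq_square)
qed (simp_all add: Gamma_two_pm)

lemma wp4_harmonic_sum_three_halves:
  "(\<lambda>k. (3/2 + 2 * real k) / (3/2) * wp4_weight (3/2) (1/2) (1/2) k
     * (\<Sum>i<k. 1 / (2 + real i)\<^sup>2 - 1 / (1/2 + real i)\<^sup>2)) sums (8 / (3 * pi) * (pi\<^sup>2 / 6 - 1))"
proof (rule wp4_harmonic_sums)
  show "rGamma (1 + 3/2) * rGamma (3/2 :: real) = 8 / (3 * pi)"
    using rGamma_half_squared by (simp add: rGamma_half_integer)
  show "Gamma 2 = (1::real)" by (simp add: Gamma_numeral)
  show "((\<lambda>x. (8 / (3 * pi) * ((1 - x\<^sup>2) * (pi * x / sin (pi * x))) - 8 / (3 * pi)) / x\<^sup>2)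
     \<longlongrightarrow> 8 / (3 * pi) * (pi\<^sup>2 / 6 - 1)) (at_right 0)"
    by (real_asymp, simp add: field_simps power2_eq_square)
qed (simp_all add: Gamma_two_pm)

section \<open>Translation to the stated series\<close>

text \<open>The stated series start at \<open>k = 1\<close>; nothing is lost because the inner
  harmonic sum is empty at \<open>k = 0\<close>.\<close>

lemma sums_Suc_scaled:
  fixes f g :: "nat \<Rightarrow> real"
  assumes "f sums s" "f 0 = 0" "\<And>k. g k = c * f k" "c * s = s'"
  shows "(\<lambda>n. let k = n + 1 in g k) sums s'"
proof -
  have "(\<lambda>n. f (Suc n)) sums s"
    using assms(1,2) sums_Suc_iff[of f s] by simp
  from sums_mult[OF this, of c] show ?thesis
    using assms(3,4) by (simp add: Let_def)
qed

lemma pochhammer_2: "pochhammer 2 k = (fact (k + 1) :: real)"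
  using pochhammer_plus1[of 1 k] by (simp add: pochhammer_fact[symmetric])

lemma pochhammer_3: "pochhammer 3 k = (fact (k + 2) :: real) / 2"
  using pochhammer_plus1[of 2 k] by (simp add: pochhammer_2 algebra_simps)

text \<open>The terms \<open>2j + 1\<close> and \<open>2j + 2\<close> are paired, and a factor 2 is
  taken out of each base before squaring.\<close>

lemma alternating_sum_pairs:
  "(\<Sum>i = 1..2 * k. (- 1) ^ (i - 1) / (real i)\<^sup>2)
    = - 1/4 * (\<Sum>i<k. 1 / (1 + real i)\<^sup>2 - 1 / (1/2 + real i)\<^sup>2)"
proof (induction k)
  case (Suc k)
  have pair: "- 1/4 * H + 1 / (2 * p)\<^sup>2 - 1 / (2 * q)\<^sup>2 = - 1/4 * (H + (1 / q\<^sup>2 - 1 / p\<^sup>2))"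
    for H p q :: real
    by (simp add: power_mult_distrib diff_divide_distrib add_divide_distrib)
  have "(\<Sum>i = 1..2 * Suc k. (- 1) ^ (i - 1) / (real i)\<^sup>2)
      = (\<Sum>i = 1..2 * k. (- 1) ^ (i - 1) / (real i)\<^sup>2)
        + 1 / (2 * (1/2 + real k))\<^sup>2 - 1 / (2 * (1 + real k))\<^sup>2"
    by (simp add: algebra_simps)
  also have "\<dots> = - 1/4 * (\<Sum>i<Suc k. 1 / (1 + real i)\<^sup>2 - 1 / (1/2 + real i)\<^sup>2)"
    unfolding Suc sum.lessThan_Suc by (rule pair)
  finally show ?case .
qed simp

lemma odd_sum_shift:
  "(\<Sum>i = 1..k. 1 / (1 + real i)\<^sup>2 - 4 / (2 * real i - 1)\<^sup>2)
    = (\<Sum>i<k. 1 / (2 + real i)\<^sup>2 - 1 / (1/2 + real i)\<^sup>2)"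
proof -
  have "2 * real (Suc i) - 1 = 2 * (1/2 + real i)" "1 + real (Suc i) = 2 + real i" for i
    by simp_all
  then show ?thesis
    by (simp only: One_nat_def sum.atLeast1_atMost_eq power_mult_distrib) simp
qed

lemma odd_sum_shift':
  "(\<Sum>i = 1..k. 1 / (2 * real i - 1)\<^sup>2 - 1 / (4 * (real i + 1)\<^sup>2))
    = - 1/4 * (\<Sum>i<k. 1 / (2 + real i)\<^sup>2 - 1 / (1/2 + real i)\<^sup>2)"
proof -
  have "1 / p - 1 / (4 * q) = - 1/4 * (1 / q - 4 / p)" for p q :: real
    by (simp add: diff_divide_distrib)
  then show ?thesis
    unfolding odd_sum_shift[symmetric] sum_distrib_left by (simp only: add.commute)
qed

lemma sums_identity_1:
  "(\<lambda>n::nat. let k = n + 1 in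
      (4 * real k + 1)
      * (pochhammer (- 1/2 :: real) k * pochhammer (1/2) k ^ 3 / (fact (k + 1) * fact k ^ 3))
      * (\<Sum>i = 1..2 * k. (- 1) ^ (i - 1) / (real i)\<^sup>2))
    sums (2/3 - 8 / pi\<^sup>2)"
\<comment> \<open>The linear factor is already \<open>4k + 1\<close>, so the constant is the
  \<open>- 1/4\<close> of \<open>alternating_sum_pairs\<close>.\<close>
proof (rule sums_Suc_scaled[OF wp5_harmonic_sum_half_neg_half, of _ "- 1/4"])
  fix k
  have w: "wp5_weight (1/2) (-1/2) (1/2) (1/2) k
      = pochhammer (- 1/2) k * pochhammer (1/2) k ^ 3 / (fact (k + 1) * fact k ^ 3)"
    by (simp add: wp5_weight_def pochhammer_2 pochhammer_fact[symmetric] power3_eq_cube mult_ac)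
  have factor: "(4 * s + 1) * X * (- 1/4 * H) = - 1/4 * ((1/2 + 2 * s) / (1/2) * X * H)" for s X H :: real
    by (simp add: algebra_simps)
  show "(4 * real k + 1) * (pochhammer (- 1/2 :: real) k * pochhammer (1/2) k ^ 3 / (fact (k + 1) * fact k ^ 3))
      * (\<Sum>i = 1..2 * k. (- 1) ^ (i - 1) / (real i)\<^sup>2)
    = - 1/4 * ((1/2 + 2 * real k) / (1/2) * wp5_weight (1/2) (-1/2) (1/2) (1/2) k
      * (\<Sum>i<k. 1 / (1 + real i)\<^sup>2 - 1 / (1/2 + real i)\<^sup>2))"
    unfolding w alternating_sum_pairs by (rule factor)
qed (simp_all add: field_simps)

lemma sums_identity_2:
  "(\<lambda>n::nat. let k = n + 1 in
      (4 * real k + 3)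
      * (pochhammer (- 1/2 :: real) k * pochhammer (1/2) k ^ 2 * pochhammer (3/2) k
         / (fact k * fact (k + 1) ^ 2 * fact (k + 2)))
      * (\<Sum>i = 1..k. 1 / (2 * real i - 1)\<^sup>2 - 1 / (4 * (real i + 1)\<^sup>2)))
    sums (32/27 - 992 / (81 * pi\<^sup>2))"
\<comment> \<open>The constant combines 3 from \<open>(3/2 + 2k) / (3/2) = (4k + 3) / 3\<close>,
  \<open>1/2\<close> from \<open>pochhammer_3\<close> and \<open>- 1/4\<close> from the inner
  sum.\<close>
proof (rule sums_Suc_scaled[OF wp5_harmonic_sum_three_halves_neg_half, of _ "- 3/8"])
  fix k
  have w: "wp5_weight (3/2) (-1/2) (1/2) (1/2) k
      = 2 * (pochhammer (- 1/2) k * pochhammer (1/2) k ^ 2 * pochhammer (3/2) k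
        / (fact k * fact (k + 1) ^ 2 * fact (k + 2)))"
    by (simp add: wp5_weight_def pochhammer_2 pochhammer_3 power2_eq_square mult_ac)
  have factor: "(4 * s + 3) * X * (- 1/4 * H) = - 3/8 * ((3/2 + 2 * s) / (3/2) * (2 * X) * H)" for s X H :: real
    by (simp add: algebra_simps)
  show "(4 * real k + 3) * (pochhammer (- 1/2 :: real) k * pochhammer (1/2) k ^ 2 * pochhammer (3/2) k
         / (fact k * fact (k + 1) ^ 2 * fact (k + 2)))
      * (\<Sum>i = 1..k. 1 / (2 * real i - 1)\<^sup>2 - 1 / (4 * (real i + 1)\<^sup>2))
    = - 3/8 * ((3/2 + 2 * real k) / (3/2) * wp5_weight (3/2) (-1/2) (1/2) (1/2) k
      * (\<Sum>i<k. 1 / (2 + real i)\<^sup>2 - 1 / (1/2 + real i)\<^sup>2))"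
    unfolding w odd_sum_shift' by (rule factor)
qed (simp_all add: field_simps)

lemma sums_identity_3:
  "(\<lambda>n::nat. let k = n + 1 in
      (4 * real k + 3)
      * (pochhammer (3/2 :: real) k * pochhammer (1/2) k ^ 3 / (fact k * fact (k + 1) ^ 3))
      * (\<Sum>i = 1..k. 1 / (2 * real i - 1)\<^sup>2 - 1 / (4 * (real i + 1)\<^sup>2)))
    sums (8/3 - 24 / pi\<^sup>2)"
\<comment> \<open>As before, but all partner symbols are those of 2, so no factor \<open>1/2\<close>
  arises.\<close>
proof (rule sums_Suc_scaled[OF wp5_harmonic_sum_three_halves_half, of _ "- 3/4"])
  fix k
  have w: "wp5_weight (3/2) (1/2) (1/2) (1/2) k
      = pochhammer (3/2) k * pochhammer (1/2) k ^ 3 / (fact k * fact (k + 1) ^ 3)"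
    by (simp add: wp5_weight_def pochhammer_2 power3_eq_cube mult_ac)
  have factor: "(4 * s + 3) * X * (- 1/4 * H) = - 3/4 * ((3/2 + 2 * s) / (3/2) * X * H)" for s X H :: real
    by (simp add: algebra_simps)
  show "(4 * real k + 3) * (pochhammer (3/2 :: real) k * pochhammer (1/2) k ^ 3 / (fact k * fact (k + 1) ^ 3))
      * (\<Sum>i = 1..k. 1 / (2 * real i - 1)\<^sup>2 - 1 / (4 * (real i + 1)\<^sup>2))
    = - 3/4 * ((3/2 + 2 * real k) / (3/2) * wp5_weight (3/2) (1/2) (1/2) (1/2) k
      * (\<Sum>i<k. 1 / (2 + real i)\<^sup>2 - 1 / (1/2 + real i)\<^sup>2))"
    unfolding w odd_sum_shift' by (rule factor)
qed (simp_all add: field_simps)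

lemma sums_identity_4:
  "(\<lambda>n::nat. let k = n + 1 in
      (- 1) ^ k * (4 * real k + 3)
      * (pochhammer (3/2 :: real) k * pochhammer (1/2) k ^ 2 / (fact k * fact (k + 1) ^ 2))
      * (\<Sum>i = 1..k. 1 / (1 + real i)\<^sup>2 - 4 / (2 * real i - 1)\<^sup>2))
    sums (4 * pi / 3 - 8 / pi)"
\<comment> \<open>Only the linear factor contributes: the inner sum matches without
  rescaling.\<close>
proof (rule sums_Suc_scaled[OF wp4_harmonic_sum_three_halves, of _ 3])
  fix k
  have w: "wp4_weight (3/2) (1/2) (1/2) k
      = (- 1) ^ k * (pochhammer (3/2) k * pochhammer (1/2) k ^ 2 / (fact k * fact (k + 1) ^ 2))"
    by (simp add: wp4_weight_def pochhammer_2 power2_eq_square mult_ac)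
  have factor: "e * (4 * s + 3) * X * H = 3 * ((3/2 + 2 * s) / (3/2) * (e * X) * H)" for e s X H :: real
    by (simp add: algebra_simps)
  show "(- 1) ^ k * (4 * real k + 3) * (pochhammer (3/2 :: real) k * pochhammer (1/2) k ^ 2 / (fact k * fact (k + 1) ^ 2))
      * (\<Sum>i = 1..k. 1 / (1 + real i)\<^sup>2 - 4 / (2 * real i - 1)\<^sup>2)
    = 3 * ((3/2 + 2 * real k) / (3/2) * wp4_weight (3/2) (1/2) (1/2) k
      * (\<Sum>i<k. 1 / (2 + real i)\<^sup>2 - 1 / (1/2 + real i)\<^sup>2))"
    unfolding w odd_sum_shift by (rule factor)
qed (simp_all add: field_simps power2_eq_square)

theorem theorem2p3:
  shows
    "((\<lambda>n::nat. let k = n + 1 in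
        (4 * real k + 1)
        * (pochhammer (- 1/2 :: real) k * pochhammer (1/2) k ^ 3 / (fact (k + 1) * fact k ^ 3))
        * (\<Sum>i = 1..2 * k. (- 1) ^ (i - 1) / (real i)\<^sup>2))
      sums (2/3 - 8 / pi\<^sup>2))
     \<and>
     ((\<lambda>n::nat. let k = n + 1 in
        (4 * real k + 3)
        * (pochhammer (- 1/2 :: real) k * pochhammer (1/2) k ^ 2 * pochhammer (3/2) k
           / (fact k * fact (k + 1) ^ 2 * fact (k + 2)))
        * (\<Sum>i = 1..k. 1 / (2 * real i - 1)\<^sup>2 - 1 / (4 * (real i + 1)\<^sup>2)))
      sums (32/27 - 992 / (81 * pi\<^sup>2)))
     \<and>
     ((\<lambda>n::nat. let k = n + 1 in
        (4 * real k + 3)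
        * (pochhammer (3/2 :: real) k * pochhammer (1/2) k ^ 3 / (fact k * fact (k + 1) ^ 3))
        * (\<Sum>i = 1..k. 1 / (2 * real i - 1)\<^sup>2 - 1 / (4 * (real i + 1)\<^sup>2)))
      sums (8/3 - 24 / pi\<^sup>2))
     \<and>
     ((\<lambda>n::nat. let k = n + 1 in
        (- 1) ^ k * (4 * real k + 3)
        * (pochhammer (3/2 :: real) k * pochhammer (1/2) k ^ 2 / (fact k * fact (k + 1) ^ 2))
        * (\<Sum>i = 1..k. 1 / (1 + real i)\<^sup>2 - 4 / (2 * real i - 1)\<^sup>2))
      sums (4 * pi / 3 - 8 / pi))"
  by (intro conjI sums_identity_1 sums_identity_2 sums_identity_3 sums_identity_4)

end
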